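(* Let $d,k,n$ be positive integers with $k\geq4$ and $d\geq k-1$, and write $V_n=\{1,\ldots,n\}\times\{1,2\}$ for the vertex set of $P_n\,\Box\,P_2$. (1) If $n\leq d$, then $\mathrm{gp}^k_d(P_n\,\Box\,P_2)=|B_{k,d}\cap V_n|$ if $1\leq n<2k-3$, and $\mathrm{gp}^k_d(P_n\,\Box\,P_2)=|A_{k,d}\cap V_n|$ if $n\geq 2k-3$. (2) If $n\geq d+1$ and $d<2k-3$, then $\mathrm{gp}^k_d(P_n\,\Box\,P_2)=|B_{k,d}\cap V_n|$. (3) If $n\geq d+1$ and $d\geq 2k-3$, then $\mathrm{gp}^k_d(P_n\,\Box\,P_2)=\max\bigl(|A_{k,d}\cap V_n|,\,|B_{k,d}\cap V_n|\bigr)$.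
   Context: $P_n\,\Box\,P_2$ is the grid with vertex set $\{1,\ldots,n\}\times\{1,2\}$, where $(i,j)$ and $(i',j')$ are adjacent iff either $j=j'$ and $|i-i'|=1$, or $i=i'$ and $j\neq j'$. For a graph $G$, a geodesic is a shortest path between two vertices; its length $\lambda(g)$ is its number of edges. For $d\ge1$, $k\ge2$, $S\subseteq V(G)$ is a $k$-general $d$-position set if every geodesic $g$ with $|S\cap V(g)|\geq k$ has $\lambda(g)>d$; $\mathrm{gp}^k_d(G)$ is the largest cardinality of such a set. For integers $d\ge1,k\ge2$ with $d\geq 2k-3$, define $A_{k,d}=\bigcup_{s\ge0}A_{k,d}(s)\subseteq\mathbb{Z}_{\ge1}\times\{1,2\}$, where $A_{k,d}(s)=\{(i,1+\frac{1+(-1)^{i+s}}{2}) : i\in[ds+1,ds+2k-3]\}$. For $d\geq k-2$, define $B_{k,d}=\bigcup_{s\ge0}[ds+1,ds+k-2]\times\{1,2\}$. Here $[a,b]$ denotes the set of integers $i$ with $a\le i\le b$. *)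

theory Defs
  imports "Graph_Theory.Graph_Theory"
begin

(* An undirected simple graph is represented, as usual in Graph_Theory, by a symmetric loop-free
   digraph (locale graph / pair_graph); paths are vertex lists. *)

definition geodesic :: "('a, 'b) pre_digraph \<Rightarrow> 'a vwalk \<Rightarrow> bool" where
  "geodesic G p \<longleftrightarrow>
     vpath p G \<and>
     (\<forall>q. vpath q G \<and> hd q = hd p \<and> last q = last p \<longrightarrow> vwalk_length p \<le> vwalk_length q)"

definition general_position_set :: "nat \<Rightarrow> nat \<Rightarrow> ('a, 'b) pre_digraph \<Rightarrow> 'a set \<Rightarrow> bool" where
  "general_position_set k d G S \<longleftrightarrow>
     S \<subseteq> verts G \<and> (\<forall>p. geodesic G p \<and> card (S \<inter> set p) \<ge> k \<longrightarrow> vwalk_length p > d)"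

(* The Max ranges over a nonempty set when k is positive (S = {} qualifies), and over a finite one
   when G is finite. *)
definition gp :: "nat \<Rightarrow> nat \<Rightarrow> ('a, 'b) pre_digraph \<Rightarrow> nat" where
  "gp k d G = Max (card ` {S. general_position_set k d G S})"

definition grid_verts :: "nat \<Rightarrow> (nat \<times> nat) set" where
  "grid_verts n = {1..n} \<times> {1, 2}"

definition grid :: "nat \<Rightarrow> (nat \<times> nat) pair_pre_digraph" where
  "grid n =
     \<lparr> pverts = grid_verts n,
       parcs = {((i, j), (i', j')). (i, j) \<in> grid_verts n \<and> (i', j') \<in> grid_verts n \<and>
                  (j = j' \<and> \<bar>int i - int i'\<bar> = 1 \<or> i = i' \<and> j \<noteq> j')} \<rparr>"

lemma pair_graph_grid: "pair_graph (grid n)"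
proof -
  have arc: "(u, v) \<in> parcs (grid n) \<longleftrightarrow>
      u \<in> grid_verts n \<and> v \<in> grid_verts n \<and>
      (snd u = snd v \<and> \<bar>int (fst u) - int (fst v)\<bar> = 1 \<or> fst u = fst v \<and> snd u \<noteq> snd v)" for u v
    by (cases u; cases v) (simp add: grid_def)
  have verts: "pverts (grid n) = grid_verts n"
    by (simp add: grid_def)
  have fin: "finite (grid_verts n)"
    by (simp add: grid_verts_def)
  have sub: "parcs (grid n) \<subseteq> grid_verts n \<times> grid_verts n"
    using arc by (metis mem_Sigma_iff subrelI)
  show ?thesis
  proof unfold_locales
    show "finite (pverts (grid n))"
      using verts fin by simp
    show "finite (parcs (grid n))"
      using sub fin by (meson finite_SigmaI finite_subset)
    show "symmetric (with_proj (grid n))"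
      unfolding symmetric_def arcs_ends_conv sym_def by (auto simp: arc)
  next
    fix e assume "e \<in> parcs (grid n)"
    moreover obtain u v where "e = (u, v)"
      by (cases e)
    ultimately show "fst e \<in> pverts (grid n)" "snd e \<in> pverts (grid n)" "fst e \<noteq> snd e"
      by (auto simp: arc verts)
  qed
qed

(* Meant for k \<ge> 2 (and d \<ge> 2 * k - 3), where the subtraction below does not truncate. *)
definition A_block :: "nat \<Rightarrow> nat \<Rightarrow> nat \<Rightarrow> (nat \<times> nat) set" where
  "A_block k d s =
     {(i, 1 + nat ((1 + (- 1) ^ (i + s)) div 2)) | i. i \<in> {d * s + 1 .. d * s + 2 * k - 3}}"

definition A_set :: "nat \<Rightarrow> nat \<Rightarrow> (nat \<times> nat) set" where
  "A_set k d = (\<Union>s. A_block k d s)"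

(* Meant for k \<ge> 2 (and d \<ge> k - 2). *)
definition B_set :: "nat \<Rightarrow> nat \<Rightarrow> (nat \<times> nat) set" where
  "B_set k d = (\<Union>s. {d * s + 1 .. d * s + k - 2} \<times> {1, 2})"

end

(* A geodesic of the ladder runs monotonically through its columns and changes rows at most once.
   Upper bounds: the two geodesics traversing a window of at most d columns and changing rows in its
   column c in opposite directions show that the points of S in the window, with column c counted
   twice, number at most 2k - 2. Hence such a window holds at most 2k - 3 points, and at most 2k - 4
   if it has a full column; without full columns it holds at most as many points as columns. The
   theorem follows by cutting the ladder into windows. Lower bounds: B, and a set with one point in
   each column of A whose rows alternate, are periodic, so every window of d columns meets them in
   at most 2k - 4 and 2k - 3 points. *)

theory Submission
  imports Defs
begin

section \<open>Geodesics of the ladder\<close>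

text \<open>The graph distance of the ladder: the distances of the two factors add up, namely the
  column distance and one edge for a change of rows.\<close>

definition gdist :: "nat \<times> nat \<Rightarrow> nat \<times> nat \<Rightarrow> nat" where
  "gdist u v = nat \<bar>int (fst u) - int (fst v)\<bar> + (if snd u = snd v then 0 else 1)"

lemma pverts_grid [simp]: "pverts (grid n) = grid_verts n"
  by (simp add: grid_def)

lemma parcs_grid_iff:
  "((i, j), (i', j')) \<in> parcs (grid n) \<longleftrightarrow>
     (i, j) \<in> grid_verts n \<and> (i', j') \<in> grid_verts n \<and>
     (j = j' \<and> \<bar>int i - int i'\<bar> = 1 \<or> i = i' \<and> j \<noteq> j')"
  by (simp add: grid_def)

lemma finite_grid_verts: "finite (grid_verts n)"
  by (simp add: grid_verts_def)

lemma gdist_arc: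
  assumes "(u, v) \<in> parcs (grid n)"
  shows "gdist u w \<le> Suc (gdist v w)"
  using assms by (cases u; cases v; cases w) (auto simp: parcs_grid_iff gdist_def)

text \<open>The step case also supplies that the tail \<open>v # es\<close> is a walk, so that
  \<open>vwalk_gdist_le\<close> can be applied to it.\<close>

lemma vwalk_step_induct [consumes 1, case_names Base Cons]:
  assumes "vwalk p G"
    and "\<And>u. u \<in> verts G \<Longrightarrow> P [u]"
    and "\<And>u v es. (u, v) \<in> arcs_ends G \<Longrightarrow> vwalk (v # es) G \<Longrightarrow> P (v # es) \<Longrightarrow> P (u # v # es)"
  shows "P p"
  using assms(1)
proof (induction p rule: list.induct)
  case Nil
  then show ?case by (simp add: vwalk_def)
next
  case (Cons u p)
  show ?case
  proof (cases p)
    case Nil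
    then show ?thesis using Cons.prems assms(2) by (simp add: vwalk_def)
  next
    case (Cons v es)
    then have "vwalk (v # es) G" "(u, v) \<in> arcs_ends G"
      using Cons.prems by (auto simp: vwalk_def)
    then show ?thesis using local.Cons Cons.IH assms(3) by simp
  qed
qed

text \<open>Along an arc the distance to a fixed vertex changes by at most one. Allowing every
  \<open>x\<close> on the walk, not just its head, also shows below that shortest walks repeat no
  vertex.\<close>

lemma vwalk_gdist_le:
  assumes "vwalk p (grid n)" and "x \<in> set p"
  shows "gdist x (last p) \<le> length p - 1"
  using assms
proof (induction p arbitrary: x rule: vwalk_induct)
  case (Base u)
  then show ?case by (simp add: gdist_def)
next
  case (Cons u v es)
  have arc: "(u, v) \<in> parcs (grid n)" using Cons.hyps by simp
  have IH: "gdist y (last (v # es)) \<le> length (v # es) - 1" if "y \<in> set (v # es)" for y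
    using Cons.IH that by blast
  show ?case
  proof (cases "x = u")
    case True
    then show ?thesis using gdist_arc[OF arc, of "last (v # es)"] IH[of v] by auto
  next
    case False
    then show ?thesis using IH[of x] Cons.prems by auto
  qed
qed

lemma vwalk_Cons_gridI:
  assumes "vwalk p (grid n)" and "(u, hd p) \<in> parcs (grid n)"
  shows "vwalk (u # p) (grid n)"
proof (rule vwalk_consI)
  show "u \<in> verts (grid n)"
    using assms(2) by (cases u; cases "hd p") (auto simp: parcs_grid_iff pverts_grid)
qed (use assms in auto)

lemma vwalk_single: "u \<in> grid_verts n \<Longrightarrow> vwalk [u] (grid n)"
  by (auto simp: vwalk_def pverts_grid)

lemma gdist_eq_0: "gdist u v = 0 \<longleftrightarrow> u = v"
  by (cases u; cases v) (auto simp: gdist_def)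

text \<open>Move towards \<open>v\<close> along the row while the columns differ, and change rows
  only in the column of \<open>v\<close>.\<close>

lemma gdist_neighbour:
  assumes "u \<in> grid_verts n" "v \<in> grid_verts n" "gdist u v = Suc m"
  obtains w where "(u, w) \<in> parcs (grid n)" "gdist w v = m"
proof -
  obtain i j i' j' where uv: "u = (i, j)" "v = (i', j')" by (cases u; cases v) auto
  have "i < i' \<or> i > i' \<or> i = i' \<and> j \<noteq> j'"
    using assms(3) uv by (auto simp: gdist_def split: if_splits)
  then consider "i < i'" | "i > i'" | "i = i'" "j \<noteq> j'" by blast
  then show thesis
  proof cases
    case 1
    then show thesis using assms uv
      by (intro that[of "(Suc i, j)"]) (auto simp: parcs_grid_iff gdist_def grid_verts_def)
  next
    case 2
    then show thesis using assms uv
      by (intro that[of "(i - 1, j)"]) (auto simp: parcs_grid_iff gdist_def grid_verts_def)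
  next
    case 3
    then show thesis using assms uv
      by (intro that[of "(i, j')"]) (auto simp: parcs_grid_iff gdist_def grid_verts_def)
  qed
qed

lemma ex_shortest_vwalk:
  assumes "u \<in> grid_verts n" "v \<in> grid_verts n"
  shows "\<exists>p. vwalk p (grid n) \<and> hd p = u \<and> last p = v \<and> length p = Suc (gdist u v)"
  using assms(1)
proof (induction "gdist u v" arbitrary: u)
  case 0
  then have "u = v" by (metis gdist_eq_0)
  then show ?case using 0 by (intro exI[of _ "[u]"]) (auto simp: vwalk_single gdist_def)
next
  case (Suc m)
  obtain w where w: "(u, w) \<in> parcs (grid n)" "gdist w v = m"
    using gdist_neighbour Suc.prems assms(2) Suc.hyps(2) by metis
  then have "w \<in> grid_verts n"
    by (cases u; cases w) (auto simp: parcs_grid_iff)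
  then obtain p where p: "vwalk p (grid n)" "hd p = w" "last p = v" "length p = Suc m"
    using Suc.hyps(1) w by blast
  then have "p \<noteq> []" by auto
  then show ?case using p w Suc.hyps(2)
    by (intro exI[of _ "u # p"]) (auto intro: vwalk_Cons_gridI)
qed

lemma shortest_vwalk_distinct:
  assumes "vwalk p (grid n)" and "length p = Suc (gdist (hd p) (last p))"
  shows "distinct p"
  using assms
proof (induction p rule: vwalk_step_induct)
  case (Base u)
  then show ?case by simp
next
  case (Cons u v es)
  have walk: "vwalk (v # es) (grid n)" using Cons.hyps by simp
  have arc: "(u, v) \<in> parcs (grid n)" using Cons.hyps by simp
  have "gdist v (last (v # es)) \<le> length es"
    using vwalk_gdist_le[OF walk, of v] by simp
  then have "length (v # es) = Suc (gdist (hd (v # es)) (last (v # es)))"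
    using gdist_arc[OF arc, of "last (v # es)"] Cons.prems by auto
  then have "distinct (v # es)" using Cons.IH by blast
  moreover have "u \<notin> set (v # es)"
    using vwalk_gdist_le[OF walk, of u] Cons.prems by auto
  ultimately show ?case by simp
qed

text \<open>The lower bound \<open>vwalk_gdist_le\<close> is attained by
  \<open>ex_shortest_vwalk\<close>, so minimality becomes an equation for the length, and
  distinctness follows from it. \<open>Suc\<close> appears because \<open>length\<close> counts
  vertices.\<close>

lemma geodesic_grid_iff:
  "geodesic (grid n) p \<longleftrightarrow> vwalk p (grid n) \<and> length p = Suc (gdist (hd p) (last p))"
proof
  assume g: "geodesic (grid n) p"
  then have walk: "vwalk p (grid n)" by (auto simp: geodesic_def)
  then have ne: "p \<noteq> []" and sub: "set p \<subseteq> grid_verts n" by (auto simp: vwalk_def pverts_grid)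
  then have "hd p \<in> grid_verts n" "last p \<in> grid_verts n" by auto
  then obtain q where q: "vwalk q (grid n)" "hd q = hd p" "last q = last p"
      "length q = Suc (gdist (hd p) (last p))"
    using ex_shortest_vwalk by meson
  then have "vpath q (grid n)" using shortest_vwalk_distinct[of q] by auto
  then have "length p - 1 \<le> length q - 1" using g q by (auto simp: geodesic_def)
  moreover have "gdist (hd p) (last p) \<le> length p - 1"
    using vwalk_gdist_le[OF walk, of "hd p"] ne by auto
  moreover have "length p \<noteq> 0" using ne by simp
  ultimately show "vwalk p (grid n) \<and> length p = Suc (gdist (hd p) (last p))"
    using q walk by linarith
next
  assume p: "vwalk p (grid n) \<and> length p = Suc (gdist (hd p) (last p))"
  have "length p - 1 \<le> length q - 1"
    if "vpath q (grid n)" "hd q = hd p" "last q = last p" for q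
  proof -
    have q: "vwalk q (grid n)" using that by auto
    then have "hd q \<in> set q" by (auto simp: vwalk_def)
    then have "gdist (hd q) (last q) \<le> length q - 1" by (rule vwalk_gdist_le[OF q])
    then show ?thesis using that p by simp
  qed
  then show "geodesic (grid n) p"
    using p shortest_vwalk_distinct[of p] by (auto simp: geodesic_def)
qed

text \<open>Every arc must lower the distance to the end by one. Hence horizontal arcs run towards
  \<open>i'\<close>, and a vertical arc leads into the final row. The column \<open>c\<close> is
  where the row changes.\<close>

lemma shortest_vwalk_bend:
  assumes "vwalk p (grid n)" and "length p = Suc (gdist (hd p) (last p))"
    and "hd p = (i, j)" and "last p = (i', j')"
  shows "\<exists>c. min i i' \<le> c \<and> c \<le> max i i' \<and>
    set p \<subseteq> {min i c..max i c} \<times> {j} \<union> {min c i'..max c i'} \<times> {j'}"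
  using assms
proof (induction p arbitrary: i j rule: vwalk_step_induct)
  case (Base u)
  then show ?case by auto
next
  case (Cons u v es)
  have walk: "vwalk (v # es) (grid n)" using Cons.hyps by simp
  have arc: "(u, v) \<in> parcs (grid n)" using Cons.hyps by simp
  have "gdist v (last (v # es)) \<le> length es"
    using vwalk_gdist_le[OF walk, of v] by simp
  then have len: "length (v # es) = Suc (gdist (hd (v # es)) (last (v # es)))"
    using gdist_arc[OF arc, of "last (v # es)"] Cons.prems by auto
  obtain x y where v: "v = (x, y)" by (cases v)
  have u: "u = (i, j)" and last: "last (v # es) = (i', j')" using Cons.prems by auto
  obtain c where c: "min x i' \<le> c" "c \<le> max x i'"
      "set (v # es) \<subseteq> {min x c..max x c} \<times> {y} \<union> {min c i'..max c i'} \<times> {j'}"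
    using Cons.IH[OF len, of x y] v last by auto
  have gd: "gdist (i, j) (i', j') = Suc (gdist (x, y) (i', j'))"
    using Cons.prems(1) len last u v by simp
  from arc consider "y = j" "\<bar>int i - int x\<bar> = 1" | "x = i" "y \<noteq> j"
    by (auto simp: u v parcs_grid_iff)
  then show ?case
  proof cases
    case 1
    \<comment> \<open>A horizontal arc that lowers the distance moves towards the column
      \<open>i'\<close>, so the bend of the tail still serves.\<close>
    then have *: "i < x \<and> x \<le> i' \<or> i' \<le> x \<and> x < i"
      using gd by (auto simp: gdist_def split: if_splits)
    have sub: "set (u # v # es) \<subseteq> {min i c..max i c} \<times> {j} \<union> {min c i'..max c i'} \<times> {j'}"
    proof -
      have "{min x c..max x c} \<subseteq> {min i c..max i c}"
        using * c by auto
      then have "set (v # es) \<subseteq> {min i c..max i c} \<times> {j} \<union> {min c i'..max c i'} \<times> {j'}"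
        using c(3) 1 by blast
      then show ?thesis using u by auto
    qed
    have "min i i' \<le> c" "c \<le> max i i'" using * c(1,2) by auto
    then show ?thesis using sub by blast
  next
    \<comment> \<open>A vertical arc that lowers the distance enters row \<open>j'\<close>, where
      the rest stays; the bend is now at column \<open>i\<close>.\<close>
    case 2
    then have j': "y = j'" using gd by (auto simp: gdist_def split: if_splits)
    have "{min x c..max x c} \<subseteq> {min i i'..max i i'}" "{min c i'..max c i'} \<subseteq> {min i i'..max i i'}"
      using c 2 by auto
    then have "set (v # es) \<subseteq> {min i i'..max i i'} \<times> {j'}"
      using c(3) j' by blast
    then show ?thesis using u by (intro exI[of _ i]) auto
  qed
qed

text \<open>By \<open>shortest_vwalk_bend\<close> only straight and bent shapes occur. With at most
  \<open>d\<close> edges a straight geodesic covers up to \<open>d + 1\<close> columns, whereas a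
  bent one spends an edge on the row change and covers at most \<open>d\<close>.\<close>

lemma general_position_setI:
  assumes "S \<subseteq> grid_verts n"
    and straight: "\<And>l r j. r \<le> l + Suc d \<Longrightarrow> j \<in> {1, 2} \<Longrightarrow> card (S \<inter> {l<..r} \<times> {j}) < k"
    and bent: "\<And>l c r j j'. l < c \<Longrightarrow> c \<le> r \<Longrightarrow> r \<le> l + d \<Longrightarrow> j \<in> {1, 2} \<Longrightarrow> j' \<in> {1, 2} \<Longrightarrow>
      j \<noteq> j' \<Longrightarrow> card (S \<inter> ({l<..c} \<times> {j} \<union> {c - 1<..r} \<times> {j'})) < k"
  shows "general_position_set k d (grid n) S"
  unfolding general_position_set_def
proof (intro conjI allI impI)
  show "S \<subseteq> verts (grid n)" using assms(1) by (simp add: pverts_grid)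
next
  fix p assume p: "geodesic (grid n) p \<and> k \<le> card (S \<inter> set p)"
  then have walk: "vwalk p (grid n)" and len: "length p = Suc (gdist (hd p) (last p))"
    by (auto simp: geodesic_grid_iff)
  obtain i j i' j' where ends: "hd p = (i, j)" "last p = (i', j')"
    by (cases "hd p"; cases "last p") auto
  have "p \<noteq> []" "set p \<subseteq> grid_verts n" using walk by (auto simp: vwalk_def pverts_grid)
  then have mem: "(i, j) \<in> grid_verts n" "(i', j') \<in> grid_verts n"
    using ends by (metis hd_in_set last_in_set subsetD)+
  then have rows: "j \<in> {1, 2}" "j' \<in> {1, 2}" and pos: "1 \<le> i" "1 \<le> i'"
    by (auto simp: grid_verts_def)
  obtain c where c: "min i i' \<le> c" "c \<le> max i i'"
      "set p \<subseteq> {min i c..max i c} \<times> {j} \<union> {min c i'..max c i'} \<times> {j'}"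
    using shortest_vwalk_bend[OF walk len ends] by blast
  have le: "k \<le> card (S \<inter> T)" if "set p \<subseteq> T" for T
  proof -
    have "finite (S \<inter> T)" using assms(1) finite_grid_verts by (meson finite_Int finite_subset)
    then have "card (S \<inter> set p) \<le> card (S \<inter> T)" using that by (intro card_mono) auto
    then show ?thesis using p by simp
  qed
  have gd: "vwalk_length p = gdist (i, j) (i', j')" using len ends by simp
  show "d < vwalk_length p"
  proof (rule ccontr)
    assume "\<not> d < vwalk_length p"
    then have short: "gdist (i, j) (i', j') \<le> d" using gd by simp
    show False
    proof (cases "j = j'")
      case True
      \<comment> \<open>Columns start at 1, so the subtraction does not truncate.\<close>
      let ?l = "min i i' - 1" and ?r = "max i i'"
      have "{min i c..max i c} \<subseteq> {?l<..?r}" "{min c i'..max c i'} \<subseteq> {?l<..?r}"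
        using c pos by auto
      then have "set p \<subseteq> {?l<..?r} \<times> {j}" using c(3) True by blast
      moreover have "?r \<le> ?l + Suc d"
        using short True pos by (auto simp: gdist_def)
      ultimately show False using straight[OF _ rows(1), of ?r ?l] le[of "{?l<..?r} \<times> {j}"] by linarith
    next
      case False
      show False
      proof (cases "i \<le> i'")
        case True
        have "{min i c..max i c} = {i - 1<..c}" "{min c i'..max c i'} = {c - 1<..i'}"
          using c pos True by auto
        then have "set p \<subseteq> {i - 1<..c} \<times> {j} \<union> {c - 1<..i'} \<times> {j'}" using c(3) by simp
        from le[OF this] show False
          using bent[OF _ _ _ rows False, of "i - 1" c i'] short c False True pos
          by (simp add: gdist_def) linarith
      next
        \<comment> \<open>A path from right to left covers the same vertices as its reverse, so
          \<open>bent\<close> applies with the rows exchanged.\<close>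
        case i: False
        have "{min i c..max i c} = {c - 1<..i}" "{min c i'..max c i'} = {i' - 1<..c}"
          using c pos i by auto
        then have "set p \<subseteq> {i' - 1<..c} \<times> {j'} \<union> {c - 1<..i} \<times> {j}" using c(3) by auto
        from le[OF this] show False
          using bent[OF _ _ _ rows(2,1) False[symmetric], of "i' - 1" c i] short c False i pos
          by (simp add: gdist_def) linarith
      qed
    qed
  qed
qed

section \<open>Explicit straight and bent walks\<close>

lemma ex_straight_vwalk:
  assumes "l < r" "r \<le> n" "j \<in> {1, 2}"
  shows "\<exists>p. vwalk p (grid n) \<and> hd p = (Suc l, j) \<and> last p = (r, j) \<and>
    length p = r - l \<and> set p = {l<..r} \<times> {j}"
proof -
  have "l \<le> r - 1" using assms by simp
  then show ?thesis
  proof (induction rule: inc_induct)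
    case base
    have "{r - 1<..r} = {r}" using assms by auto
    moreover have "vwalk [(r, j)] (grid n)"
      using assms by (intro vwalk_single) (auto simp: grid_verts_def)
    ultimately show ?case using assms
      by (intro exI[of _ "[(r, j)]"]) simp
  next
    case (step m)
    then obtain p where p: "vwalk p (grid n)" "hd p = (Suc (Suc m), j)" "last p = (r, j)"
        "length p = r - Suc m" "set p = {Suc m<..r} \<times> {j}"
      by blast
    have "p \<noteq> []" using p(1) by (auto simp: vwalk_def)
    moreover have "((Suc m, j), (Suc (Suc m), j)) \<in> parcs (grid n)"
      using step.hyps assms by (auto simp: parcs_grid_iff grid_verts_def)
    moreover have "{m<..r} = insert (Suc m) {Suc m<..r}" using step.hyps by auto
    ultimately show ?case using p step.hyps
      by (intro exI[of _ "(Suc m, j) # p"]) (auto intro: vwalk_Cons_gridI)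
  qed
qed

text \<open>Downward induction on \<open>l\<close> prepends columns in row \<open>j\<close>; the
  base case puts \<open>(c, j)\<close> in front of the straight walk in row \<open>j'\<close> that
  starts in column \<open>c\<close>.\<close>

lemma ex_bent_vwalk:
  assumes "l < c" "c \<le> r" "r \<le> n" "j \<in> {1, 2}" "j' \<in> {1, 2}" "j \<noteq> j'"
  shows "\<exists>p. vwalk p (grid n) \<and> hd p = (Suc l, j) \<and> last p = (r, j') \<and>
    length p = Suc (r - l) \<and> set p = {l<..c} \<times> {j} \<union> {c - 1<..r} \<times> {j'}"
proof -
  have "l \<le> c - 1" using assms by simp
  then show ?thesis
  proof (induction rule: inc_induct)
    case base
    have "c - 1 < r" using assms by simp
    from ex_straight_vwalk[OF this assms(3,5)]
    obtain p where p: "vwalk p (grid n)" "hd p = (Suc (c - 1), j')" "last p = (r, j')"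
        "length p = r - (c - 1)" "set p = {c - 1<..r} \<times> {j'}"
      by blast
    have "p \<noteq> []" using p(1) by (auto simp: vwalk_def)
    moreover have "((c, j), (c, j')) \<in> parcs (grid n)"
      using assms by (auto simp: parcs_grid_iff grid_verts_def)
    moreover have "{c - 1<..c} = {c}" using assms by auto
    ultimately show ?case using p assms
      by (intro exI[of _ "(c, j) # p"]) (auto intro: vwalk_Cons_gridI)
  next
    case (step m)
    then obtain p where p: "vwalk p (grid n)" "hd p = (Suc (Suc m), j)" "last p = (r, j')"
        "length p = Suc (r - Suc m)" "set p = {Suc m<..c} \<times> {j} \<union> {c - 1<..r} \<times> {j'}"
      by blast
    have "p \<noteq> []" using p(1) by (auto simp: vwalk_def)
    moreover have "((Suc m, j), (Suc (Suc m), j)) \<in> parcs (grid n)"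
      using step.hyps assms by (auto simp: parcs_grid_iff grid_verts_def)
    moreover have "{m<..c} = insert (Suc m) {Suc m<..c}" using step.hyps by auto
    ultimately show ?case using p step.hyps assms
      by (intro exI[of _ "(Suc m, j) # p"]) (auto intro: vwalk_Cons_gridI)
  qed
qed

text \<open>The bent walks have length equal to the distance of their ends, so they are geodesics.
  They are the only geodesics that the upper bounds use.\<close>

lemma general_position_set_bent:
  assumes "general_position_set k d (grid n) S"
    and "l < c" "c \<le> r" "r \<le> n" "r \<le> l + d" "j \<in> {1, 2}" "j' \<in> {1, 2}" "j \<noteq> j'"
  shows "card (S \<inter> ({l<..c} \<times> {j} \<union> {c - 1<..r} \<times> {j'})) < k"
proof -
  obtain p where p: "vwalk p (grid n)" "hd p = (Suc l, j)" "last p = (r, j')"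
      "length p = Suc (r - l)" "set p = {l<..c} \<times> {j} \<union> {c - 1<..r} \<times> {j'}"
    using ex_bent_vwalk[OF assms(2-4,6-8)] by blast
  have "gdist (Suc l, j) (r, j') = r - l" using assms by (auto simp: gdist_def)
  then have "geodesic (grid n) p" using p by (simp add: geodesic_grid_iff)
  moreover have "vwalk_length p \<le> d" using p assms by simp
  ultimately have "\<not> card (S \<inter> set p) \<ge> k"
    using assms(1) unfolding general_position_set_def by (meson not_le)
  then show ?thesis using p by simp
qed

section \<open>Counting points in windows of columns\<close>

text \<open>The columns are half-open so that adjacent windows share a boundary index and a window
  has \<open>r - l\<close> columns.\<close>

definition window :: "(nat \<times> nat) set \<Rightarrow> nat \<Rightarrow> nat \<Rightarrow> (nat \<times> nat) set" where
  "window S l r = S \<inter> {l<..r} \<times> {1, 2}"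

definition full_column :: "(nat \<times> nat) set \<Rightarrow> nat \<Rightarrow> nat \<Rightarrow> bool" where
  "full_column S l r \<longleftrightarrow> (\<exists>c. l < c \<and> c \<le> r \<and> {c} \<times> {1, 2} \<subseteq> S)"

lemma finite_window: "finite (window S l r)"
  by (simp add: window_def)

lemma card_window_split:
  assumes "l \<le> m" "m \<le> r"
  shows "card (window S l r) = card (window S l m) + card (window S m r)"
proof -
  have "window S l r = window S l m \<union> window S m r" "window S l m \<inter> window S m r = {}"
    using assms by (auto simp: window_def)
  then show ?thesis by (simp add: card_Un_disjoint finite_window)
qed

text \<open>Without a full column the projection to the column is injective on the window.\<close>

lemma card_window_le_no_full_column:
  assumes "\<not> full_column S l r"
  shows "card (window S l r) \<le> r - l"
proof -
  have "inj_on fst (window S l r)"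
  proof (rule inj_onI)
    fix u v assume uv: "u \<in> window S l r" "v \<in> window S l r" "fst u = fst v"
    show "u = v"
    proof (rule ccontr)
      assume "u \<noteq> v"
      then have "{fst u} \<times> {1, 2} \<subseteq> S" "l < fst u" "fst u \<le> r"
        using uv by (auto simp: window_def)
      then show False using assms by (auto simp: full_column_def)
    qed
  qed
  moreover have "fst ` window S l r \<subseteq> {l<..r}" by (auto simp: window_def)
  ultimately have "card (window S l r) \<le> card {l<..r}"
    by (meson card_inj_on_le finite_greaterThanAtMost)
  then show ?thesis by simp
qed

lemma card_window_le_double: "card (window S l r) \<le> 2 * (r - l)"
proof -
  have "card (window S l r) \<le> card ({l<..r} \<times> {1::nat, 2})"
    by (intro card_mono) (auto simp: window_def)
  then show ?thesis by (simp add: card_cartesian_product)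
qed

lemma card_window_blocks:
  assumes "\<And>i. i < q \<Longrightarrow> card (window S (l + i * d) (l + Suc i * d)) \<le> M"
  shows "card (window S l (l + q * d)) \<le> q * M"
  using assms
proof (induction q)
  case 0
  then show ?case by (simp add: window_def)
next
  case (Suc q)
  have "card (window S l (l + Suc q * d)) =
      card (window S l (l + q * d)) + card (window S (l + q * d) (l + Suc q * d))"
    by (intro card_window_split) auto
  then show ?case using Suc.IH Suc.prems by fastforce
qed

text \<open>The two oppositely oriented geodesics that change rows in column \<open>c\<close> together cover the
  window, with column \<open>c\<close> counted twice.\<close>

lemma card_window_add_column:
  assumes "general_position_set k d (grid n) S"
    and "l < c" "c \<le> r" "r \<le> n" "r \<le> l + d"
  shows "card (window S l r) + card (window S (c - 1) c) \<le> 2 * (k - 1)"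
proof -
  let ?P = "S \<inter> ({l<..c} \<times> {1} \<union> {c - 1<..r} \<times> {2})"
  let ?Q = "S \<inter> ({l<..c} \<times> {2} \<union> {c - 1<..r} \<times> {1})"
  have fin: "finite ?P" "finite ?Q" by auto
  have "window S l r = ?P \<union> ?Q" "window S (c - 1) c = ?P \<inter> ?Q"
    using assms by (auto simp: window_def)
  then have "card (window S l r) + card (window S (c - 1) c) = card ?P + card ?Q"
    using card_Un_Int[OF fin] by simp
  moreover have "card ?P < k" "card ?Q < k"
    using general_position_set_bent[OF assms, of 1 2] general_position_set_bent[OF assms, of 2 1]
    by auto
  ultimately show ?thesis by linarith
qed

text \<open>Count the column of any point of the window twice: it contributes at least one extra to
  a total of at most \<open>2 * (k - 1)\<close>.\<close>

lemma card_window_le: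
  assumes "general_position_set k d (grid n) S" "k \<ge> 2" "r \<le> n" "r \<le> l + d"
  shows "card (window S l r) \<le> 2 * k - 3"
proof (cases "window S l r = {}")
  case True
  then show ?thesis by simp
next
  case False
  then obtain c j where c: "(c, j) \<in> window S l r" by auto
  then have "(c, j) \<in> window S (c - 1) c" "l < c" "c \<le> r" by (auto simp: window_def)
  then have "card (window S (c - 1) c) \<noteq> 0" using finite_window[of S "c - 1" c] by auto
  then show ?thesis
    using card_window_add_column[OF assms(1) \<open>l < c\<close> \<open>c \<le> r\<close> assms(3,4)] by linarith
qed

text \<open>Counting the full column twice contributes two extra to a total of at most
  \<open>2 * (k - 1)\<close>.\<close>

lemma card_window_le_full_column:
  assumes "general_position_set k d (grid n) S" "r \<le> n" "r \<le> l + d" "full_column S l r"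
  shows "card (window S l r) \<le> 2 * (k - 2)"
proof -
  obtain c where c: "l < c" "c \<le> r" "{c} \<times> {1, 2} \<subseteq> S"
    using assms(4) by (auto simp: full_column_def)
  have "{c - 1<..c} = {c}" using c by auto
  then have "window S (c - 1) c = {c} \<times> {1, 2}" using c by (auto simp: window_def)
  then have "card (window S (c - 1) c) = 2" by (simp add: card_cartesian_product)
  then show ?thesis
    using card_window_add_column[OF assms(1) c(1,2) assms(2,3)] by linarith
qed

section \<open>Periodic sets of columns\<close>

text \<open>The first \<open>m\<close> columns of each period of length \<open>d\<close>, shifted by
  one as columns start at 1. The columns of A are those for \<open>m = 2 * k - 3\<close>, the
  columns of B those for \<open>m = k - 2\<close>.\<close>

definition cols :: "nat \<Rightarrow> nat \<Rightarrow> nat set" where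
  "cols m d = {i. 1 \<le> i \<and> (i - 1) mod d < m}"

definition rank :: "nat \<Rightarrow> nat \<Rightarrow> nat \<Rightarrow> nat" where
  "rank m d x = card (cols m d \<inter> {..x})"

lemma rank_0: "rank m d 0 = 0"
  by (simp add: rank_def cols_def)

lemma rank_Suc: "rank m d (Suc x) = rank m d x + (if x mod d < m then 1 else 0)"
proof -
  have "cols m d \<inter> {..Suc x} =
      (if x mod d < m then insert (Suc x) (cols m d \<inter> {..x}) else cols m d \<inter> {..x})"
    by (auto simp: cols_def le_Suc_eq)
  then show ?thesis by (auto simp: rank_def)
qed

lemma rank_mono: "x \<le> y \<Longrightarrow> rank m d x \<le> rank m d y"
  by (auto simp: rank_def intro!: card_mono)

lemma rank_initial: "x \<le> d \<Longrightarrow> rank m d x = min x m"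
  by (induction x) (auto simp: rank_0 rank_Suc)

text \<open>Columns \<open>x + 1\<close> and \<open>x + d + 1\<close> are selected together, so the
  difference is the count \<open>m\<close> of the first period for every \<open>x\<close>.\<close>

lemma rank_shift:
  assumes "m \<le> d"
  shows "rank m d (x + d) = rank m d x + m"
proof (induction x)
  case 0
  then show ?case using rank_initial[of d d m] assms by (simp add: rank_0)
next
  case (Suc x)
  then show ?case by (simp add: rank_Suc)
qed

lemma rank_le_add:
  assumes "m \<le> d" "y \<le> x + d"
  shows "rank m d y \<le> rank m d x + m"
  using rank_mono[OF assms(2), of m d] by (simp add: rank_shift[OF assms(1)])

lemma rank_le_add_Suc:
  assumes "m \<le> d" "y \<le> x + Suc d"
  shows "rank m d y \<le> rank m d x + m + 1"
proof -
  have "rank m d y \<le> rank m d (Suc (x + d))" using assms(2) by (intro rank_mono) simp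
  also have "\<dots> \<le> rank m d (x + d) + 1" by (simp add: rank_Suc)
  finally show ?thesis by (simp add: rank_shift[OF assms(1)])
qed

lemma rank_eq:
  assumes "m \<le> d" "r \<le> d"
  shows "rank m d (q * d + r) = q * m + min r m"
proof (induction q)
  case 0
  then show ?case using rank_initial assms by simp
next
  case (Suc q)
  then show ?case using rank_shift[OF assms(1), of "q * d + r"] by (simp add: add.commute add.left_commute)
qed

text \<open>As \<open>m <= d\<close>, a block stays within its period, and
  \<open>(i - 1) mod d\<close> recovers the offset in the block.\<close>

lemma mem_cols_iff:
  assumes "m \<le> d"
  shows "i \<in> cols m d \<longleftrightarrow> (\<exists>s. i \<in> {d * s + 1..d * s + m})"
proof
  assume "i \<in> cols m d"
  moreover define s t where "s = (i - 1) div d" and "t = (i - 1) mod d"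
  ultimately have "i = d * s + t + 1" "t < m"
    by (auto simp: cols_def)
  then show "\<exists>s. i \<in> {d * s + 1..d * s + m}"
    by (intro exI[of _ s]) simp
next
  assume "\<exists>s. i \<in> {d * s + 1..d * s + m}"
  then obtain s where s: "d * s + 1 \<le> i" "i \<le> d * s + m" by auto
  then have "i - 1 = d * s + (i - 1 - d * s)" "i - 1 - d * s < m" by auto
  then have "(i - 1) mod d = i - 1 - d * s"
    using assms by (metis mod_less mod_mult_self4 order.strict_trans2)
  then show "i \<in> cols m d" using s by (auto simp: cols_def)
qed

section \<open>Cardinalities of A and B within the ladder\<close>

lemma card_A_set:
  assumes "k \<ge> 2" "2 * k - 3 \<le> d"
  shows "card (A_set k d \<inter> grid_verts n) = rank (2 * k - 3) d n"
proof -
  have row: "1 + nat ((1 + (- 1) ^ t) div 2) = (if even t then 2 else (1::nat))" for t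
    by simp
  let ?X = "A_set k d \<inter> grid_verts n"
  have blk: "(i, j) \<in> A_set k d \<longleftrightarrow>
      (\<exists>s. i \<in> {d * s + 1..d * s + (2 * k - 3)} \<and> j = (if even (i + s) then 2 else 1))" for i j
    unfolding A_set_def A_block_def row using assms(1) by auto
  \<comment> \<open>Blocks are disjoint because \<open>2 * k - 3 <= d\<close>, so a column
    determines its block and hence its row.\<close>
  have uniq: "s = s'" if "i \<in> {d * s + 1..d * s + (2 * k - 3)}" "i \<in> {d * s' + 1..d * s' + (2 * k - 3)}"
    for i s s'
  proof -
    have "(i - 1) div d = t" if "i \<in> {d * t + 1..d * t + (2 * k - 3)}" for t
      using that assms(2) by (intro div_nat_eqI) auto
    then show ?thesis using that by metis
  qed
  have "inj_on fst ?X"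
  proof (rule inj_onI)
    fix u v assume uv: "u \<in> ?X" "v \<in> ?X" "fst u = fst v"
    then obtain i j j' where "u = (i, j)" "v = (i, j')" by (cases u; cases v) auto
    then show "u = v" using uv blk[of i j] blk[of i j'] uniq[of i] by blast
  qed
  moreover have "fst ` ?X = cols (2 * k - 3) d \<inter> {..n}"
  proof (intro set_eqI iffI)
    fix i assume "i \<in> fst ` ?X"
    then show "i \<in> cols (2 * k - 3) d \<inter> {..n}"
      by (auto simp: blk mem_cols_iff[OF assms(2)] grid_verts_def)
  next
    fix i assume i: "i \<in> cols (2 * k - 3) d \<inter> {..n}"
    then obtain s where s: "i \<in> {d * s + 1..d * s + (2 * k - 3)}"
      using mem_cols_iff[OF assms(2)] by blast
    then have "(i, if even (i + s) then 2 else 1) \<in> ?X"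
      using i by (auto simp: blk grid_verts_def)
    then show "i \<in> fst ` ?X" by force
  qed
  ultimately show ?thesis by (metis card_image rank_def)
qed

lemma B_set_eq:
  assumes "k \<ge> 2" "k - 2 \<le> d"
  shows "B_set k d = cols (k - 2) d \<times> {1, 2}"
proof -
  have "d * s + k - 2 = d * s + (k - 2)" for s using assms(1) by simp
  then show ?thesis
    using mem_cols_iff[OF assms(2)] by (auto simp: B_set_def)
qed

lemma card_B_set:
  assumes "k \<ge> 2" "k - 2 \<le> d"
  shows "card (B_set k d \<inter> grid_verts n) = 2 * rank (k - 2) d n"
proof -
  have "B_set k d \<inter> grid_verts n = (cols (k - 2) d \<inter> {..n}) \<times> {1, 2}"
    by (auto simp: B_set_eq[OF assms] grid_verts_def cols_def)
  then show ?thesis by (simp add: card_cartesian_product rank_def)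
qed

section \<open>Lower bounds\<close>

lemma card_cols_interval:
  assumes "l \<le> r"
  shows "card (cols m d \<inter> {l<..r}) = rank m d r - rank m d l"
proof -
  have "cols m d \<inter> {l<..r} = (cols m d \<inter> {..r}) - (cols m d \<inter> {..l})" by auto
  moreover have "cols m d \<inter> {..l} \<subseteq> cols m d \<inter> {..r}" using assms by auto
  ultimately show ?thesis by (simp add: rank_def card_Diff_subset)
qed

text \<open>Any \<open>d\<close> consecutive columns contain at most \<open>k - 2\<close> columns of
  B. A straight geodesic sees at most one column more, and a bent one meets both points of at most
  one column, so both stay at \<open>k - 1\<close>.\<close>

lemma general_position_set_B_set:
  assumes "k \<ge> 2" "k - 2 \<le> d"
  shows "general_position_set k d (grid n) (B_set k d \<inter> grid_verts n)"
proof (rule general_position_setI)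
  let ?R = "rank (k - 2) d"
  have cnt: "card (B_set k d \<inter> grid_verts n \<inter> {l<..r} \<times> {j}) \<le> ?R r - ?R l"
    if "l \<le> r" for l r j
  proof -
    have "card (B_set k d \<inter> grid_verts n \<inter> {l<..r} \<times> {j}) \<le> card ((cols (k - 2) d \<inter> {l<..r}) \<times> {j})"
      by (intro card_mono) (auto simp: B_set_eq[OF assms])
    then show ?thesis using card_cols_interval[OF that] by (simp add: card_cartesian_product)
  qed
  {
    fix l r j :: nat assume r: "r \<le> l + Suc d"
    have "?R r \<le> ?R l + (k - 2) + 1"
      using rank_le_add_Suc[OF assms(2) r] .
    then show "card (B_set k d \<inter> grid_verts n \<inter> {l<..r} \<times> {j}) < k"
      using cnt[of l r j] assms(1) by (cases "l \<le> r") auto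
  next
    fix l c r j j' :: nat assume *: "l < c" "c \<le> r" "r \<le> l + d"
    have "?R r \<le> ?R l + (k - 2)"
      using rank_le_add[OF assms(2) *(3)] .
    moreover have "?R l \<le> ?R c" "?R (c - 1) \<le> ?R c" "?R c \<le> ?R r"
      using * by (auto intro: rank_mono)
    moreover have "?R c \<le> ?R (c - 1) + 1"
      using * rank_Suc[of "k - 2" d "c - 1"] by simp
    moreover have "card (B_set k d \<inter> grid_verts n \<inter> ({l<..c} \<times> {j} \<union> {c - 1<..r} \<times> {j'})) \<le>
        (?R c - ?R l) + (?R r - ?R (c - 1))"
      unfolding Int_Un_distrib
      using cnt[of l c j] cnt[of "c - 1" r j'] *
      by (intro order_trans[OF card_Un_le] add_mono) auto
    ultimately show "card (B_set k d \<inter> grid_verts n \<inter> ({l<..c} \<times> {j} \<union> {c - 1<..r} \<times> {j'})) < k"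
      using assms(1) by linarith
  }
qed auto

text \<open>Rows alternate along the consecutive columns of \<open>cols m d\<close>, also across block boundaries. For
  odd \<open>d\<close> the set \<open>A_set k d\<close> repeats a row at each boundary and need not be in general position;
  only its cardinality matters.\<close>

definition alternating_set :: "nat \<Rightarrow> nat \<Rightarrow> (nat \<times> nat) set" where
  "alternating_set m d = {(i, j). i \<in> cols m d \<and> j = 1 + rank m d i mod 2}"

lemma card_alternating_set: "card (alternating_set m d \<inter> grid_verts n) = rank m d n"
proof -
  let ?f = "\<lambda>i. (i, 1 + rank m d i mod 2)"
  have "alternating_set m d \<inter> grid_verts n = ?f ` (cols m d \<inter> {..n})"
    by (auto simp: alternating_set_def grid_verts_def cols_def)
  moreover have "inj_on ?f (cols m d \<inter> {..n})" by (auto intro: inj_onI)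
  ultimately show ?thesis by (simp add: card_image rank_def)
qed

text \<open>The point with rank \<open>a\<close> lies in row \<open>1 + e\<close> iff
  \<open>a\<close> has the parity of \<open>e\<close>, and \<open>(R + e) div 2\<close> of the
  numbers from 1 to \<open>R\<close> have that parity.\<close>

lemma card_alternating_row:
  assumes "e < 2"
  shows "card (alternating_set m d \<inter> {..x} \<times> {1 + e}) = (rank m d x + e) div 2"
proof (induction x)
  case 0
  have "alternating_set m d \<inter> {..0} \<times> {1 + e} = {}"
    by (auto simp: alternating_set_def cols_def)
  then show ?case using assms by (simp add: rank_0)
next
  case (Suc x)
  let ?Y = "alternating_set m d \<inter> {..x} \<times> {1 + e}"
  have fin: "finite ?Y" by (meson finite_Int finite_SigmaI finite_atMost finite.intros)
  have "alternating_set m d \<inter> {..Suc x} \<times> {1 + e} =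
      (if Suc x \<in> cols m d \<and> rank m d (Suc x) mod 2 = e then insert (Suc x, 1 + e) ?Y else ?Y)"
    by (auto simp: alternating_set_def le_Suc_eq)
  then have "card (alternating_set m d \<inter> {..Suc x} \<times> {1 + e}) =
      card ?Y + (if Suc x \<in> cols m d \<and> rank m d (Suc x) mod 2 = e then 1 else 0)"
    using fin by auto
  also have "\<dots> = (rank m d (Suc x) + e) div 2"
  proof -
    have "(a + e) div 2 + (if Suc a mod 2 = e then 1 else 0) = (Suc a + e) div 2" for a
      using assms by (auto simp: less_2_cases_iff) presburger+
    from this[of "rank m d x"] show ?thesis using Suc by (auto simp: rank_Suc cols_def split: if_splits)
  qed
  finally show ?case .
qed

lemma card_alternating_interval:
  assumes "e < 2" "l \<le> r"
  shows "card (alternating_set m d \<inter> {l<..r} \<times> {1 + e}) =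
    (rank m d r + e) div 2 - (rank m d l + e) div 2"
proof -
  have "alternating_set m d \<inter> {l<..r} \<times> {1 + e} =
      (alternating_set m d \<inter> {..r} \<times> {1 + e}) - (alternating_set m d \<inter> {..l} \<times> {1 + e})"
    by auto
  moreover have "finite (alternating_set m d \<inter> {..l} \<times> {1 + e})"
    by (meson finite_Int finite_SigmaI finite_atMost finite.intros)
  moreover have "alternating_set m d \<inter> {..l} \<times> {1 + e} \<subseteq> alternating_set m d \<inter> {..r} \<times> {1 + e}"
    using assms by auto
  ultimately show ?thesis using card_alternating_row[OF assms(1)] by (simp add: card_Diff_subset)
qed

text \<open>A straight geodesic meets a run of at most \<open>2 * k - 2\<close> consecutive ranks,
  of which at most \<open>k - 1\<close> belong to its row. For a bent one the run has at most
  \<open>2 * k - 3\<close> ranks and is cut in two at the bend, with one parity counted on each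
  side.\<close>

lemma general_position_set_alternating:
  assumes "k \<ge> 2" "2 * k - 3 \<le> d"
  defines "m \<equiv> 2 * k - 3"
  shows "general_position_set k d (grid n) (alternating_set m d \<inter> grid_verts n)"
proof (rule general_position_setI)
  let ?R = "rank m d" and ?A = "alternating_set m d"
  have md: "m \<le> d" using assms by simp
  have cnt: "card (?A \<inter> grid_verts n \<inter> T) \<le> card (?A \<inter> T)" if "finite T" for T
    using that by (intro card_mono) auto
  {
    fix l r j :: nat assume r: "r \<le> l + Suc d" and j: "j \<in> {1, 2}"
    define e where "e = j - 1"
    have e: "e < 2" "j = 1 + e" using j by (auto simp: e_def)
    have "?R r \<le> ?R l + m + 1"
      using rank_le_add_Suc[OF md r] .
    then have "(?R r + e) div 2 - (?R l + e) div 2 < k"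
      using assms(1) by (simp add: m_def)
    then show "card (?A \<inter> grid_verts n \<inter> {l<..r} \<times> {j}) < k"
      using cnt[of "{l<..r} \<times> {j}"] card_alternating_interval[OF e(1), of l r m d] e assms(1)
      by (cases "l \<le> r") auto
  next
    fix l c r j j' :: nat
    assume *: "l < c" "c \<le> r" "r \<le> l + d" "j \<in> {1, 2}" "j' \<in> {1, 2}" "j \<noteq> j'"
    define e where "e = j - 1"
    have e: "e < 2" "1 - e < 2" "j = 1 + e" "j' = 1 + (1 - e)" using * by (auto simp: e_def)
    \<comment> \<open>Column \<open>c\<close> holds at most one point, so it can be assigned to one of the two rows.\<close>
    define c' where "c' = (if (c, j) \<in> ?A then c else c - 1)"
    have c': "l \<le> c'" "c' \<le> r" using * by (auto simp: c'_def)
    have "?A \<inter> ({l<..c} \<times> {j} \<union> {c - 1<..r} \<times> {j'}) \<subseteq>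
        ?A \<inter> {l<..c'} \<times> {j} \<union> ?A \<inter> {c'<..r} \<times> {j'}"
    proof
      fix v assume v: "v \<in> ?A \<inter> ({l<..c} \<times> {j} \<union> {c - 1<..r} \<times> {j'})"
      obtain x y where xy: "v = (x, y)" by (cases v)
      have "\<not> ((c, j) \<in> ?A \<and> (c, j') \<in> ?A)" using *(6) by (auto simp: alternating_set_def)
      then show "v \<in> ?A \<inter> {l<..c'} \<times> {j} \<union> ?A \<inter> {c'<..r} \<times> {j'}"
        using v xy *(1) by (cases "x = c") (auto simp: c'_def)
    qed
    then have "card (?A \<inter> ({l<..c} \<times> {j} \<union> {c - 1<..r} \<times> {j'})) \<le>
        card (?A \<inter> {l<..c'} \<times> {j} \<union> ?A \<inter> {c'<..r} \<times> {j'})"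
      by (intro card_mono) auto
    also have "\<dots> \<le> card (?A \<inter> {l<..c'} \<times> {j}) + card (?A \<inter> {c'<..r} \<times> {j'})"
      by (rule card_Un_le)
    also have "\<dots> = ((?R c' + e) div 2 - (?R l + e) div 2) +
        ((?R r + (1 - e)) div 2 - (?R c' + (1 - e)) div 2)"
      using card_alternating_interval[OF e(1) c'(1), of m d]
        card_alternating_interval[OF e(2) c'(2), of m d] e by simp
    also have "\<dots> < k"
    proof -
      have "?R r \<le> ?R l + m"
        using rank_le_add[OF md *(3)] .
      moreover have "?R l \<le> ?R c'" "?R c' \<le> ?R r"
        using c' by (auto intro: rank_mono)
      moreover have "e = 0 \<or> e = 1" using e by auto
      moreover have "(z + e) div 2 - (x + e) div 2 + ((y + (1 - e)) div 2 - (z + (1 - e)) div 2) < k"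
        if y: "y \<le> x + (2 * k - 3)" and "x \<le> z" "z \<le> y" "e = 0 \<or> e = 1" for x y z
        using that(4)
      proof
        \<comment> \<open>Here the terms at the cut \<open>z\<close> contribute at most 0, and the
          two ends differ by at most \<open>k - 1\<close>.\<close>
        assume e: "e = 0"
        have "(y + 1) div 2 \<le> (x + (k - 1) * 2) div 2" using y assms(1) by (intro div_le_mono) simp
        also have "\<dots> = k - 1 + x div 2" by simp
        finally have "(y + 1) div 2 \<le> k - 1 + x div 2" .
        moreover have "x div 2 \<le> z div 2" "z div 2 \<le> (z + 1) div 2" "(z + 1) div 2 \<le> (y + 1) div 2"
          using that(2,3) by (auto intro: div_le_mono)
        ultimately show ?thesis using assms(1) unfolding e add_0_right diff_zero by linarith
      next
        \<comment> \<open>Here the cut may contribute 1, but the rounding at the two ends leaves at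
          most \<open>k - 2\<close>.\<close>
        assume e: "e = 1"
        have "y div 2 \<le> (x + 1 + (k - 2) * 2) div 2" using y assms(1) by (intro div_le_mono) simp
        also have "\<dots> = k - 2 + (x + 1) div 2" by (rule div_mult_self1) simp
        finally have "y div 2 \<le> k - 2 + (x + 1) div 2" .
        moreover have "(x + 1) div 2 \<le> (z + 1) div 2" "z div 2 \<le> y div 2"
          using that(2,3) by (auto intro: div_le_mono)
        moreover have "(z + 1) div 2 \<le> z div 2 + 1" by simp
        ultimately show ?thesis using assms(1) unfolding e diff_self_eq_0 add_0_right by linarith
      qed
      ultimately show ?thesis unfolding m_def by blast
    qed
    finally show "card (?A \<inter> grid_verts n \<inter> ({l<..c} \<times> {j} \<union> {c - 1<..r} \<times> {j'})) < k"
      using cnt[of "{l<..c} \<times> {j} \<union> {c - 1<..r} \<times> {j'}"] by fastforce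
  }
qed auto

section \<open>Upper bounds\<close>

lemma window_all:
  assumes "general_position_set k d (grid n) S"
  shows "window S 0 n = S"
  using assms by (auto simp: window_def general_position_set_def pverts_grid grid_verts_def)

text \<open>The short last window holds at most two points per column and at most
  \<open>2 * (k - 2)\<close> in all, exactly as B does; the full windows match the blocks of
  B.\<close>

lemma card_le_B_bound:
  assumes gp: "general_position_set k d (grid n) S" and "k - 2 \<le> d" "0 < d"
    and blocks: "\<And>i. i < n div d \<Longrightarrow> card (window S (i * d) (Suc i * d)) \<le> 2 * (k - 2)"
    and rest: "card (window S (n div d * d) n) \<le> 2 * (k - 2)"
  shows "card S \<le> 2 * rank (k - 2) d n"
proof -
  define q r where "q = n div d" and "r = n mod d"
  have n: "n = q * d + r" by (simp add: q_def r_def)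
  have "r < d" using assms(3) by (simp add: r_def)
  have "card S = card (window S 0 (q * d)) + card (window S (q * d) n)"
    using card_window_split[of 0 "q * d" n S] window_all[OF gp] n by simp
  moreover have "card (window S 0 (q * d)) \<le> q * (2 * (k - 2))"
    using card_window_blocks[of q S 0 d "2 * (k - 2)"] blocks by (simp add: q_def)
  moreover have "card (window S (q * d) n) \<le> 2 * min r (k - 2)"
  proof -
    have "card (window S (q * d) n) \<le> 2 * r"
      using card_window_le_double[of S "q * d" n] n by simp
    then show ?thesis using rest[folded q_def] by simp
  qed
  moreover have "rank (k - 2) d n = q * (k - 2) + min r (k - 2)"
    using rank_eq[of "k - 2" d r q] n \<open>r < d\<close> assms(2) by simp
  ultimately show ?thesis by simp
qed

text \<open>Without a full column there are at most as many points as columns, that is at most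
  \<open>2 * k - 4\<close>; a full column forces the same bound.\<close>

lemma card_window_le_narrow:
  assumes "general_position_set k d (grid n) S" "k \<ge> 2" "r \<le> n" "r \<le> l + d" "r - l < 2 * k - 3"
  shows "card (window S l r) \<le> 2 * (k - 2)"
proof (cases "full_column S l r")
  case True
  then show ?thesis using card_window_le_full_column assms by blast
next
  case False
  then show ?thesis using card_window_le_no_full_column[OF False] assms(5) by simp
qed

text \<open>No window of the cut has more than \<open>min n d\<close> columns, so one argument
  serves short ladders and small \<open>d\<close>.\<close>

lemma card_le_narrow:
  assumes gp: "general_position_set k d (grid n) S" and "k \<ge> 2" "k - 2 \<le> d" "0 < d"
    and narrow: "min n d < 2 * k - 3"
  shows "card S \<le> 2 * rank (k - 2) d n"
proof (rule card_le_B_bound[OF gp assms(3,4)])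
  fix i assume "i < n div d"
  then have "Suc i * d \<le> n div d * d" by (intro mult_le_mono1) simp
  also have "\<dots> \<le> n" by simp
  finally have "Suc i * d \<le> n" .
  then show "card (window S (i * d) (Suc i * d)) \<le> 2 * (k - 2)"
    using narrow by (intro card_window_le_narrow[OF gp assms(2)]) auto
next
  have "n - n div d * d = n mod d" by (simp add: minus_div_mult_eq_mod)
  moreover have "n mod d < d" "n mod d \<le> n" using assms(4) by auto
  ultimately show "card (window S (n div d * d) n) \<le> 2 * (k - 2)"
    using narrow by (intro card_window_le_narrow[OF gp assms(2)]) linarith+
qed

text \<open>Cut the ladder into windows of \<open>d\<close> columns and a single short one of \<open>n mod d\<close> columns, which
  can be placed after any number \<open>t\<close> of the long ones. If \<open>S\<close> beats the alternating set, then for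
  each \<open>t\<close> the short window has a full column, and a full column limits the count of any window
  containing it to \<open>2 * (k - 2)\<close>.\<close>

lemma card_le_wide:
  assumes gp: "general_position_set k d (grid n) S" and "k \<ge> 2" "2 * k - 3 \<le> d"
  shows "card S \<le> max (rank (2 * k - 3) d n) (2 * rank (k - 2) d n)"
proof (cases "card S \<le> rank (2 * k - 3) d n")
  case False
  define q r where "q = n div d" and "r = n mod d"
  have d0: "0 < d" using assms by linarith
  have n: "n = q * d + r" by (simp add: q_def r_def)
  have r: "r < d" using d0 by (simp add: r_def)
  \<comment> \<open>If not, the short window holds at most \<open>min r (2 * k - 3)\<close> points
    and each long one at most \<open>2 * k - 3\<close>. These sum to
    \<open>rank (2 * k - 3) d n\<close> wherever the short window stands.\<close>
  have full: "full_column S (t * d) (t * d + r)" if "t \<le> q" for t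
  proof (rule ccontr)
    assume "\<not> full_column S (t * d) (t * d + r)"
    then have le_r: "card (window S (t * d) (t * d + r)) \<le> r"
      using card_window_le_no_full_column by fastforce
    have td: "t * d \<le> q * d" using that by simp
    have n': "n = t * d + r + (q - t) * d" using n td by (simp add: diff_mult_distrib)
    have "card (window S (t * d) (t * d + r)) \<le> 2 * k - 3"
      using n td r by (intro card_window_le[OF gp assms(2)]) auto
    moreover have "card (window S 0 (0 + t * d)) \<le> t * (2 * k - 3)"
    proof (rule card_window_blocks)
      fix i assume "i < t"
      then have "Suc i * d \<le> t * d" by (intro mult_le_mono1) simp
      then have "0 + Suc i * d \<le> n" using n td by linarith
      then show "card (window S (0 + i * d) (0 + Suc i * d)) \<le> 2 * k - 3"
        by (intro card_window_le[OF gp assms(2)]) auto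
    qed
    moreover have "card (window S (t * d + r) (t * d + r + (q - t) * d)) \<le> (q - t) * (2 * k - 3)"
    proof (rule card_window_blocks)
      fix i assume "i < q - t"
      then have "Suc i * d \<le> (q - t) * d" by (intro mult_le_mono1) simp
      then show "card (window S (t * d + r + i * d) (t * d + r + Suc i * d)) \<le> 2 * k - 3"
        using n' by (intro card_window_le[OF gp assms(2)]) auto
    qed
    moreover have "card S = card (window S 0 (t * d)) + card (window S (t * d) (t * d + r)) +
        card (window S (t * d + r) n)"
      using card_window_split[of 0 "t * d" n S] card_window_split[of "t * d" "t * d + r" n S]
        window_all[OF gp] n td by simp
    moreover have "rank (2 * k - 3) d n = t * (2 * k - 3) + min r (2 * k - 3) + (q - t) * (2 * k - 3)"
    proof -
      have "rank (2 * k - 3) d n = q * (2 * k - 3) + min r (2 * k - 3)"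
        using rank_eq[of "2 * k - 3" d r q] n r assms(3) by simp
      moreover have "q * (2 * k - 3) = t * (2 * k - 3) + (q - t) * (2 * k - 3)"
        using that by (metis add_mult_distrib le_add_diff_inverse)
      ultimately show ?thesis by simp
    qed
    ultimately show False
      using False le_r unfolding n'[symmetric] add_0 by linarith
  qed
  have "card S \<le> 2 * rank (k - 2) d n"
  proof (rule card_le_B_bound[OF gp _ d0])
    show "k - 2 \<le> d" using assms by linarith
  next
    fix i assume i: "i < n div d"
    then have "Suc i * d \<le> q * d" unfolding q_def by (intro mult_le_mono1) simp
    then have "Suc i * d \<le> n" using n by linarith
    \<comment> \<open>The short window placed after \<open>i\<close> long ones forms the first
      \<open>r\<close> columns of this long window.\<close>
    moreover have "full_column S (i * d) (Suc i * d)"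
      using full[of i] i r by (fastforce simp: full_column_def q_def)
    ultimately show "card (window S (i * d) (Suc i * d)) \<le> 2 * (k - 2)"
      by (intro card_window_le_full_column[OF gp]) auto
  next
    have "full_column S (q * d) n" "n \<le> q * d + d" using full[of q] n r by simp_all
    then show "card (window S (n div d * d) n) \<le> 2 * (k - 2)"
      unfolding q_def by (intro card_window_le_full_column[OF gp]) auto
  qed
  then show ?thesis by simp
qed simp

lemma gp_eqI:
  assumes "general_position_set k d (grid n) S" "card S = m"
    and "\<And>T. general_position_set k d (grid n) T \<Longrightarrow> card T \<le> m"
  shows "gp k d (grid n) = m"
  unfolding gp_def
proof (rule Max_eqI)
  have "{S. general_position_set k d (grid n) S} \<subseteq> Pow (grid_verts n)"
    by (auto simp: general_position_set_def pverts_grid)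
  then show "finite (card ` {S. general_position_set k d (grid n) S})"
    using finite_grid_verts by (meson finite_Pow_iff finite_imageI finite_subset)
qed (use assms in auto)

theorem theorem6p7:
  fixes k d n :: nat
  assumes "k \<ge> 4" and "d \<ge> k - 1" and "n \<ge> 1"
  shows
    "(n \<le> d \<longrightarrow>
        (n < 2 * k - 3 \<longrightarrow> gp k d (grid n) = card (B_set k d \<inter> grid_verts n)) \<and>
        (n \<ge> 2 * k - 3 \<longrightarrow> gp k d (grid n) = card (A_set k d \<inter> grid_verts n))) \<and>
     (n \<ge> d + 1 \<and> d < 2 * k - 3 \<longrightarrow>
        gp k d (grid n) = card (B_set k d \<inter> grid_verts n)) \<and>
     (n \<ge> d + 1 \<and> d \<ge> 2 * k - 3 \<longrightarrow>
        gp k d (grid n) =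
          max (card (A_set k d \<inter> grid_verts n)) (card (B_set k d \<inter> grid_verts n)))"
proof -
  have k2: "k \<ge> 2" and kd: "k - 2 \<le> d" and d0: "0 < d" using assms by linarith+
  note cB = card_B_set[OF k2 kd, of n]
  note gB = general_position_set_B_set[OF k2 kd, of n]
  have narrow: "gp k d (grid n) = card (B_set k d \<inter> grid_verts n)" if "min n d < 2 * k - 3"
    using card_le_narrow[OF _ k2 kd d0 that] cB by (intro gp_eqI[OF gB]) auto
  have wide: "gp k d (grid n) =
      max (card (A_set k d \<inter> grid_verts n)) (card (B_set k d \<inter> grid_verts n))"
    if "2 * k - 3 \<le> d"
  proof -
    \<comment> \<open>The alternating set attains the cardinality of A and is in general
      position.\<close>
    let ?X = "alternating_set (2 * k - 3) d \<inter> grid_verts n"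
    have A: "general_position_set k d (grid n) ?X" "card ?X = card (A_set k d \<inter> grid_verts n)"
      using general_position_set_alternating[OF k2 that] card_alternating_set card_A_set[OF k2 that]
      by simp_all
    have le: "card T \<le> max (card (A_set k d \<inter> grid_verts n)) (card (B_set k d \<inter> grid_verts n))"
      if "general_position_set k d (grid n) T" for T
      using card_le_wide[OF that k2 \<open>2 * k - 3 \<le> d\<close>] cB card_A_set[OF k2 \<open>2 * k - 3 \<le> d\<close>] by simp
    show ?thesis
    proof (cases "card (A_set k d \<inter> grid_verts n) \<le> card (B_set k d \<inter> grid_verts n)")
      case True
      then show ?thesis using le by (intro gp_eqI[OF gB]) auto
    next
      case False
      then show ?thesis using le A(2) by (intro gp_eqI[OF A(1)]) auto
    qed
  qed
  \<comment> \<open>For \<open>n <= d\<close> only the first block counts: A has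
    \<open>2 * k - 3\<close> points and B has \<open>2 * k - 4\<close>, so the maximum is attained
    by A.\<close>
  have short: "card (B_set k d \<inter> grid_verts n) \<le> card (A_set k d \<inter> grid_verts n)"
    if "2 * k - 3 \<le> n" "n \<le> d"
    using that cB card_A_set[OF k2, of d n] rank_initial[of n d] by simp
  show ?thesis using narrow wide short by (auto simp: max_def)
qed

end
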